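(* Let $G$ be a finite simple undirected graph with $\operatorname{girth}(G)\ge 2\chi(G)-1$. Then $G$ is sc-orientable.
   Context: $\chi(G)$ is the chromatic number of $G$; the girth is the length of a shortest cycle (infinite if $G$ is acyclic). A directed graph $D$ is singly connected if for every ordered pair of vertices $(s,t)$ there is at most one directed path from $s$ to $t$ in $D$. For an undirected graph $G$, an $E(G)$-orientation is a map $\sigma$ assigning to each edge one of its endpoints (its head), giving a directed graph $G_\sigma$; $\sigma$ is an sc-orientation if $G_\sigma$ is singly connected, and $G$ is sc-orientable if it has an sc-orientation. *)

theory Defs
  imports "Graph_Theory.Pair_Digraph" "HOL-Library.Extended_Nat"
begin

text \<open>
  A finite simple undirected graph is a \<^locale>\<open>pair_graph\<close>: a finite loopfree pair digraph
  with a symmetric arc relation, each undirected edge \<open>{u, v}\<close> being represented by the two arcs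
  \<open>(u, v)\<close> and \<open>(v, u)\<close>.
\<close>

definition uedges :: "'a pair_pre_digraph \<Rightarrow> 'a set set" where
  "uedges G = {{u, v} | u v. (u, v) \<in> parcs G}"

definition proper_colouring :: "'a pair_pre_digraph \<Rightarrow> nat \<Rightarrow> ('a \<Rightarrow> nat) \<Rightarrow> bool" where
  "proper_colouring G k c \<longleftrightarrow>
     (\<forall>v \<in> pverts G. c v < k) \<and> (\<forall>u v. {u, v} \<in> uedges G \<longrightarrow> c u \<noteq> c v)"

definition chromatic_number :: "'a pair_pre_digraph \<Rightarrow> nat" where
  "chromatic_number G = (LEAST k. \<exists>c. proper_colouring G k c)"

text \<open>
  In the symmetric representation \<^const>\<open>pre_digraph.cycle\<close> also holds of the back-and-forth walk
  \<open>u, v, u\<close> along a single edge; every longer cycle of a simple graph has length at least 3.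
\<close>

definition ucycle :: "'a pair_pre_digraph \<Rightarrow> ('a \<times> 'a) awalk \<Rightarrow> bool" where
  "ucycle G p \<longleftrightarrow> pre_digraph.cycle (with_proj G) p \<and> 3 \<le> length p"

text \<open>The infimum of the empty set in \<^typ>\<open>enat\<close> is \<open>\<infinity>\<close>, which covers acyclic graphs.\<close>

definition girth :: "'a pair_pre_digraph \<Rightarrow> enat" where
  "girth G = (INF p \<in> {p. ucycle G p}. enat (length p))"

text \<open>Directed paths are \<^const>\<open>pre_digraph.apath\<close>, i.e. walks without repeated vertices.\<close>

definition singly_connected :: "('a, 'b) pre_digraph \<Rightarrow> bool" where
  "singly_connected D \<longleftrightarrow>
     (\<forall>s \<in> verts D. \<forall>t \<in> verts D. \<exists>\<^sub>\<le>\<^sub>1 p. pre_digraph.apath D s p t)"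

definition edge_orientation :: "'a pair_pre_digraph \<Rightarrow> ('a set \<Rightarrow> 'a) \<Rightarrow> bool" where
  "edge_orientation G \<sigma> \<longleftrightarrow> (\<forall>e \<in> uedges G. \<sigma> e \<in> e)"

definition oriented_graph :: "'a pair_pre_digraph \<Rightarrow> ('a set \<Rightarrow> 'a) \<Rightarrow> 'a pair_pre_digraph" where
  "oriented_graph G \<sigma> =
     \<lparr> pverts = pverts G, parcs = {(u, v). (u, v) \<in> parcs G \<and> \<sigma> {u, v} = v} \<rparr>"

definition sc_orientation :: "'a pair_pre_digraph \<Rightarrow> ('a set \<Rightarrow> 'a) \<Rightarrow> bool" where
  "sc_orientation G \<sigma> \<longleftrightarrow>
     edge_orientation G \<sigma> \<and> singly_connected (with_proj (oriented_graph G \<sigma>))"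

definition sc_orientable :: "'a pair_pre_digraph \<Rightarrow> bool" where
  "sc_orientable G \<longleftrightarrow> (\<exists>\<sigma>. sc_orientation G \<sigma>)"

end

theory Submission
  imports Defs
begin

text \<open>
  Orient every edge of an optimally coloured graph towards its endpoint of larger colour. Colours
  increase along directed paths, so these have at most \<open>\<chi>(G) - 1\<close> arcs. Two distinct directed paths
  with common ends would contain a cycle of length at most \<open>2 \<chi>(G) - 2\<close>, which is below the girth.
\<close>

lemma length_rev_path [simp]: "length (rev_path p) = length p"
  by (induct p) auto

text \<open>Going out along \<open>p\<close> and back along \<open>q\<close> closes up at
  \<open>s\<close>. A cycle may repeat only its starting vertex, so the vertices of \<open>p\<close>
  after \<open>s\<close> must avoid those of \<open>q\<close> before \<open>t\<close>. A common one
  could only be \<open>s\<close> or \<open>t\<close>, and each of these is missing from one of the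
  two lists.\<close>

lemma (in pair_sym_digraph) ucycle_if_internally_disjoint_apaths:
  assumes p: "apath s p t" and q: "apath s q t" and "p \<noteq> q"
    and disjoint: "set (awalk_verts s p) \<inter> set (awalk_verts s q) \<subseteq> {s, t}"
  shows "ucycle G (p @ rev_path q)"
proof -
  \<comment> \<open>A path without repeated vertices is empty exactly when its ends coincide, so an
    empty \<open>p\<close> or \<open>q\<close> would force \<open>p = q\<close>.\<close>
  have ne: "p \<noteq> []" "q \<noteq> []"
    using apath_ends[OF p p] apath_ends[OF q q] \<open>p \<noteq> q\<close> by auto
  have wp: "awalk s p t" and wq: "awalk s q t"
    using p q by (auto simp: apath_def)
  have dp: "distinct (awalk_verts s p)" and dq: "distinct (awalk_verts s q)"
    using p q by (auto simp: apath_def)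
  have walk: "awalk s (p @ rev_path q) s"
    using wp wq by (intro awalk_appendI[of _ _ t]) auto
  have "awalk_verts s (p @ rev_path q) = awalk_verts s p @ tl (rev (awalk_verts s q))"
    using awalk_verts_append[OF walk] wp wq by (simp add: awalk_verts_rev_path)
  then have verts: "tl (awalk_verts s (p @ rev_path q))
      = tl (awalk_verts s p) @ rev (butlast (awalk_verts s q))"
    by (simp add: tl_rev)
  have "s \<notin> set (tl (awalk_verts s p))"
    using dp wp by (cases p) (auto simp: awalk_simps)
  moreover have "t \<notin> set (butlast (awalk_verts s q))"
  proof -
    have "awalk_verts s q = butlast (awalk_verts s q) @ [t]"
      using wq by (metis append_butlast_last_id awalk_verts_non_Nil awlast_of_awalk NOMATCH_def)
    then show ?thesis
      using dq by (metis distinct_append disjoint_iff list.set_intros(1))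
  qed
  ultimately have "set (tl (awalk_verts s p)) \<inter> set (butlast (awalk_verts s q)) = {}"
    using disjoint in_set_butlastD[of _ "awalk_verts s q"] list.set_sel(2)[of "awalk_verts s p"]
    by auto
  then have "cycle (p @ rev_path q)"
    unfolding cycle_def using walk dp dq ne
    by (intro exI[of _ s]) (simp add: verts distinct_tl distinct_butlast)
  \<comment> \<open>This rules out the back-and-forth walk along one edge: arcs are pairs, so two
    single arcs from \<open>s\<close> to \<open>t\<close> are equal.\<close>
  moreover have "length p + length q \<noteq> 2"
  proof
    assume "length p + length q = 2"
    then obtain a b where "p = [a]" "q = [b]"
      using ne by (cases p; cases q) auto
    then show False
      using wp wq \<open>p \<noteq> q\<close> by (auto simp: awalk_simps prod_eq_iff)
  qed
  ultimately show ?thesis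
    using ne by (cases p; cases q) (auto simp: ucycle_def Suc_le_eq)
qed

text \<open>Induction on the total length: at a shared inner vertex both paths are cut, and either
  their first or their second pieces still differ.\<close>

lemma (in pair_sym_digraph) short_ucycle_if_distinct_apaths:
  assumes "apath s p t" and "apath s q t" and "p \<noteq> q"
  obtains r where "ucycle G r" and "length r \<le> length p + length q"
proof -
  have "\<exists>r. ucycle G r \<and> length r \<le> length p + length q"
    using assms
  proof (induction "length p + length q" arbitrary: s t p q rule: less_induct)
    case less
    note p = less.prems(1) and q = less.prems(2)
    show ?case
    proof (cases "set (awalk_verts s p) \<inter> set (awalk_verts s q) \<subseteq> {s, t}")
      case True
      then show ?thesis
        using ucycle_if_internally_disjoint_apaths[OF p q \<open>p \<noteq> q\<close>]
        by (intro exI[of _ "p @ rev_path q"]) simp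
    next
      case False
      then obtain v where v: "v \<in> set (awalk_verts s p)" "v \<in> set (awalk_verts s q)" "v \<noteq> s" "v \<noteq> t"
        by auto
      obtain p1 p2 where p12: "p = p1 @ p2" "awalk s p1 v" "awalk v p2 t"
        using awalk_decomp[OF awalkI_apath[OF p] v(1)] by auto
      obtain q1 q2 where q12: "q = q1 @ q2" "awalk s q1 v" "awalk v q2 t"
        using awalk_decomp[OF awalkI_apath[OF q] v(2)] by auto
      have paths: "apath s p1 v" "apath v p2 t" "apath s q1 v" "apath v q2 t"
        using p q p12 q12 by (auto simp: apath_append_iff)
      \<comment> \<open>Since \<open>v\<close> is neither end, no piece is empty, so each pair of
        pieces has smaller total length and the induction hypothesis applies.\<close>
      have ne: "p1 \<noteq> []" "p2 \<noteq> []" "q1 \<noteq> []" "q2 \<noteq> []"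
        using p12 q12 v by (auto simp: awalk_simps)
      have "p1 \<noteq> q1 \<or> p2 \<noteq> q2"
        using \<open>p \<noteq> q\<close> p12 q12 by auto
      then show ?thesis
      proof
        assume "p1 \<noteq> q1"
        then have "\<exists>r. ucycle G r \<and> length r \<le> length p1 + length q1"
          using ne p12 q12 paths by (intro less.hyps) auto
        then show ?thesis
          using p12 q12 by fastforce
      next
        assume "p2 \<noteq> q2"
        then have "\<exists>r. ucycle G r \<and> length r \<le> length p2 + length q2"
          using ne p12 q12 paths by (intro less.hyps) auto
        then show ?thesis
          using p12 q12 by fastforce
      qed
    qed
  qed
  then show thesis
    using that by blast
qed

lemma girth_le_length: "ucycle G p \<Longrightarrow> girth G \<le> enat (length p)"
  by (auto simp: girth_def intro: INF_lower)

text \<open>\<open>LEAST\<close> is attained once some number of colours suffices; numbering the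
  finitely many vertices injectively provides one.\<close>

lemma (in pair_graph) chromatic_number_colouring:
  obtains c where "proper_colouring G (chromatic_number G) c"
proof -
  obtain f :: "'a \<Rightarrow> nat" and n where f: "f ` pverts G = {i. i < n}" "inj_on f (pverts G)"
    using finite_imp_inj_to_nat_seg[OF pair_finite_verts] by blast
  have "f u \<noteq> f v" if "{u, v} \<in> uedges G" for u v
  proof -
    from that have "u \<in> pverts G" "v \<in> pverts G" "u \<noteq> v"
      by (auto simp: uedges_def doubleton_eq_iff dest: wellformed' no_loops')
    then show ?thesis
      using f(2) by (auto dest: inj_onD)
  qed
  with f(1) have "proper_colouring G n f"
    by (auto simp: proper_colouring_def)
  then have "\<exists>k c. proper_colouring G k c"
    by blast
  then have "\<exists>c. proper_colouring G (chromatic_number G) c"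
    unfolding chromatic_number_def by (rule LeastI_ex)
  then show thesis
    using that by blast
qed

text \<open>The choice is arbitrary between endpoints of equal colour, so this orients edges for
  every \<open>c\<close>; properness matters only for the strict increase along arcs.\<close>

definition colour_orientation :: "('a \<Rightarrow> nat) \<Rightarrow> 'a set \<Rightarrow> 'a" where
  "colour_orientation c e = (SOME v. v \<in> e \<and> (\<forall>u \<in> e. c u \<le> c v))"

lemma colour_orientation_pair:
  "colour_orientation c {u, v} \<in> {u, v} \<and> (\<forall>w \<in> {u, v}. c w \<le> c (colour_orientation c {u, v}))"
proof -
  have "\<exists>x. x \<in> {u, v} \<and> (\<forall>w \<in> {u, v}. c w \<le> c x)"
    using linear[of "c u" "c v"] by auto
  then show ?thesis
    unfolding colour_orientation_def by (rule someI_ex)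
qed

lemma edge_orientation_colour: "edge_orientation G (colour_orientation c)"
  using colour_orientation_pair[of c] by (fastforce simp: edge_orientation_def uedges_def)

lemma colour_less_if_oriented:
  assumes "proper_colouring G k c"
    and "(u, v) \<in> parcs (oriented_graph G (colour_orientation c))"
  shows "c u < c v"
proof -
  have "{u, v} \<in> uedges G" and v: "colour_orientation c {u, v} = v"
    using assms(2) by (auto simp: oriented_graph_def uedges_def)
  then have "c u \<noteq> c v"
    using assms(1) by (auto simp: proper_colouring_def)
  moreover have "c u \<le> c v"
    using colour_orientation_pair[of c u v] v by auto
  ultimately show ?thesis
    by simp
qed

lemma length_add_le_if_pcas:
  fixes c :: "'a \<Rightarrow> nat"
  assumes "pcas s p t" and "\<And>u v. (u, v) \<in> set p \<Longrightarrow> c u < c v"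
  shows "c s + length p \<le> c t"
  using assms
proof (induction p arbitrary: s)
  case (Cons e p)
  then have "c (snd e) + length p \<le> c t" and "c s < c (snd e)"
    by (cases e; auto)+
  then show ?case
    by simp
qed simp

theorem theorem5:
  fixes G :: "'a pair_pre_digraph"
  assumes "pair_graph G"
    and "girth G \<ge> enat (2 * chromatic_number G - 1)"
  shows "sc_orientable G"
proof -
  interpret pair_graph G by fact
  obtain c where c: "proper_colouring G (chromatic_number G) c"
    by (rule chromatic_number_colouring)
  define D where "D = oriented_graph G (colour_orientation c)"
  \<comment> \<open>Paths of \<open>D\<close> are moved to \<open>G\<close>, where arcs can be
    reversed to close a cycle. Their length is at most \<open>c t - c s\<close>, and
    \<open>c t\<close> is below the number of colours.\<close>
  have path: "apath s p t" and len: "length p < chromatic_number G"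
    if "pre_digraph.apath (with_proj D) s p t" for s p t
  proof -
    have D: "s \<in> pverts G" "set p \<subseteq> parcs D" "pcas s p t" "distinct (awalk_verts s p)"
      using that by (auto simp: pre_digraph.apath_def pre_digraph.awalk_def cas_with_proj_eq
          awalk_verts_with_proj_eq D_def oriented_graph_def)
    then show apath: "apath s p t"
      by (auto simp: apath_def awalk_def D_def oriented_graph_def)
    have "c s + length p \<le> c t"
      using D colour_less_if_oriented[OF c] by (intro length_add_le_if_pcas) (auto simp: D_def)
    moreover have "t \<in> pverts G"
      using apath by (auto simp: apath_def)
    ultimately show "length p < chromatic_number G"
      using c by (fastforce simp: proper_colouring_def)
  qed
  have "p = q" if p: "pre_digraph.apath (with_proj D) s p t" and q: "pre_digraph.apath (with_proj D) s q t"
    for s p q t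
  proof (rule ccontr)
    assume "p \<noteq> q"
    then obtain r where r: "ucycle G r" "length r \<le> length p + length q"
      using short_ucycle_if_distinct_apaths[OF path[OF p] path[OF q]] by blast
    \<comment> \<open>The two lengths sum to at most \<open>2 * chromatic_number G - 2\<close>. The
      truncated subtraction is harmless, as \<open>len\<close> makes the chromatic number
      positive.\<close>
    have "2 * chromatic_number G - 1 \<le> length r"
      using order_trans[OF assms(2) girth_le_length[OF r(1)]] by simp
    with r(2) len[OF p] len[OF q] show False
      by simp
  qed
  then have "singly_connected (with_proj D)"
    by (auto simp: singly_connected_def Uniq_def)
  then show ?thesis
    unfolding sc_orientable_def sc_orientation_def D_def using edge_orientation_colour by blast
qed

end
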